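(* Let $(X,d,\preccurlyeq)$ be a preordered quasi-metric space and $\varphi:X\to\mathbb{R}\cup\{\infty\}$ a proper bounded below function. For $x\in X$ put $S(x)=\{y\in X: x\preccurlyeq y \text{ and } \varphi(y)+d(y,x)\le\varphi(x)\}$. Then the following statements are equivalent. (wEk) There exists $z\in\operatorname{dom}\varphi$ such that $\varphi(y)=\varphi(z)$ for all $y\in S(z)$. (Tak) The following implication holds: if for every $x\in\operatorname{dom}\varphi$ $$\inf\varphi(X)<\varphi(x)\ \Rightarrow\ \exists y\in S(x),\ \varphi(y)<\varphi(x),$$ then there exists $z\in\operatorname{dom}\varphi$ with $\varphi(z)=\inf\varphi(X)$. (Car) For every mapping $T:X\to X$ satisfying $Tx\in S(x)$ for all $x\in\operatorname{dom}\varphi$, there exists $z\in\operatorname{dom}\varphi$ such that $\varphi(Tz)=\varphi(z)$ and $Tz\in\overline{\{z\}}$.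
   Context: A quasi-metric on a set $X$ is a map $d:X\times X\to[0,\infty)$ with $d(x,x)=0$, $d(x,z)\le d(x,y)+d(y,z)$, and $d(x,y)=d(y,x)=0\Rightarrow x=y$ (symmetry is not required). The topology $\tau_d$ is generated by the balls $B_d(x,r)=\{y: d(x,y)<r\}$; $\overline{A}$ is the $\tau_d$-closure (so $y\in\overline{\{x\}}$ iff $d(y,x)=0$). A preordered quasi-metric space $(X,d,\preccurlyeq)$ is a quasi-metric space with a reflexive and transitive relation $\preccurlyeq$. For $\varphi:X\to\mathbb{R}\cup\{\infty\}$, $\operatorname{dom}\varphi=\{x:\varphi(x)<\infty\}$; $\varphi$ is proper if $\operatorname{dom}\varphi\ne\emptyset$. *)

theory Defs
  imports "HOL-Analysis.Analysis"
begin

text \<open>As in the library locale \<^locale>\<open>Metric_space\<close>, the underlying set is an explicit carrier;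
  the values of \<open>d\<close>, of the preorder and of functions outside the carrier are irrelevant.\<close>

locale quasi_metric_space =
  fixes X :: "'a set" and d :: "'a \<Rightarrow> 'a \<Rightarrow> real"
  assumes nonneg: "\<And>x y. x \<in> X \<Longrightarrow> y \<in> X \<Longrightarrow> 0 \<le> d x y"
    and zero: "\<And>x. x \<in> X \<Longrightarrow> d x x = 0"
    and triangle: "\<And>x y z. x \<in> X \<Longrightarrow> y \<in> X \<Longrightarrow> z \<in> X \<Longrightarrow> d x z \<le> d x y + d y z"
    and separated: "\<And>x y. x \<in> X \<Longrightarrow> y \<in> X \<Longrightarrow> d x y = 0 \<Longrightarrow> d y x = 0 \<Longrightarrow> x = y"

locale preordered_quasi_metric_space = quasi_metric_space X d
  for X :: "'a set" and d :: "'a \<Rightarrow> 'a \<Rightarrow> real" +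
  fixes le :: "'a \<Rightarrow> 'a \<Rightarrow> bool"
  assumes reflp_le: "reflp_on X le"
    and transp_le: "transp_on X le"

definition qball :: "'a set \<Rightarrow> ('a \<Rightarrow> 'a \<Rightarrow> real) \<Rightarrow> 'a \<Rightarrow> real \<Rightarrow> 'a set" where
  "qball X d x r = {y \<in> X. d x y < r}"

definition qtopology :: "'a set \<Rightarrow> ('a \<Rightarrow> 'a \<Rightarrow> real) \<Rightarrow> 'a topology" where
  "qtopology X d = topology_generated_by {qball X d x r | x r. x \<in> X \<and> 0 < r}"

text \<open>Functions into \<open>\<real> \<union> {\<infinity>}\<close> are \<^typ>\<open>ereal\<close>-valued functions that avoid \<open>-\<infinity>\<close> on the carrier.\<close>

definition ext_real_fun :: "'a set \<Rightarrow> ('a \<Rightarrow> ereal) \<Rightarrow> bool" where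
  "ext_real_fun X \<phi> \<longleftrightarrow> (\<forall>x\<in>X. \<phi> x \<noteq> -\<infinity>)"

definition eff_dom :: "'a set \<Rightarrow> ('a \<Rightarrow> ereal) \<Rightarrow> 'a set" where
  "eff_dom X \<phi> = {x \<in> X. \<phi> x < \<infinity>}"

definition proper_fun :: "'a set \<Rightarrow> ('a \<Rightarrow> ereal) \<Rightarrow> bool" where
  "proper_fun X \<phi> \<longleftrightarrow> eff_dom X \<phi> \<noteq> {}"

text \<open>The lower bound is a real number: every \<^typ>\<open>ereal\<close>-valued function is bounded below
  by \<open>-\<infinity>\<close>.\<close>

definition bounded_below_fun :: "'a set \<Rightarrow> ('a \<Rightarrow> ereal) \<Rightarrow> bool" where
  "bounded_below_fun X \<phi> \<longleftrightarrow> (\<exists>m::real. \<forall>x\<in>X. ereal m \<le> \<phi> x)"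

text \<open>Note the order of the arguments in \<open>d y x\<close>.\<close>

definition S_set ::
  "'a set \<Rightarrow> ('a \<Rightarrow> 'a \<Rightarrow> real) \<Rightarrow> ('a \<Rightarrow> 'a \<Rightarrow> bool) \<Rightarrow> ('a \<Rightarrow> ereal) \<Rightarrow> 'a \<Rightarrow> 'a set" where
  "S_set X d le \<phi> x = {y \<in> X. le x y \<and> \<phi> y + ereal (d y x) \<le> \<phi> x}"

end

theory Submission
  imports Defs
begin

text \<open>For \<open>y \<in> S x\<close> always \<open>\<phi> y \<le> \<phi> x\<close>, and equality of the (finite) values forces \<open>d y x = 0\<close>,
  that is, \<open>y\<close> lies in the closure of \<open>x\<close>. So (wEk) fails iff every \<open>x\<close> in the domain admits a strict
  descent \<open>y \<in> S x\<close>. Such descents are the premise of (Tak), contradict the existence of a minimizer,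
  and choosing one for every \<open>x\<close> defines a mapping that violates (Car).\<close>

text \<open>If a ball around \<open>c\<close> contains \<open>y\<close>, then
  \<open>d c x \<le> d c y + d y x = d c y\<close> puts \<open>x\<close> into the same ball. This
  property survives finite intersections and arbitrary unions, so induction over the generated
  topology carries it to every open set.\<close>

lemma (in quasi_metric_space) in_closure_of_singletonI:
  assumes "x \<in> X" "y \<in> X" "d y x = 0"
  shows "y \<in> qtopology X d closure_of {x}"
proof -
  have "y \<in> U \<longrightarrow> x \<in> U"
    if "generate_topology_on {qball X d x r | x r. x \<in> X \<and> 0 < r} U" for U
    using that
  proof induction
    case (Basis U)
    then obtain c r where U: "U = qball X d c r" and c: "c \<in> X" by blast
    show ?case
      using triangle[OF c assms(2,1)] assms by (auto simp: U qball_def)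
  qed auto
  \<comment> \<open>The space of a generated topology is the union of its generators, so some ball
    has to contain \<open>y\<close>; radius 1 is an arbitrary choice.\<close>
  moreover have "y \<in> topspace (qtopology X d)"
  proof -
    have "y \<in> qball X d y 1"
      using assms(2) zero by (simp add: qball_def)
    moreover have "qball X d y 1 \<in> {qball X d x r | x r. x \<in> X \<and> 0 < r}"
      using assms(2) zero_less_one by blast
    ultimately show ?thesis
      unfolding qtopology_def topology_generated_by_topspace by blast
  qed
  ultimately show ?thesis
    by (auto simp: in_closure_of qtopology_def openin_topology_generated_by_iff)
qed

lemma (in quasi_metric_space) S_set_le:
  assumes "x \<in> X" "y \<in> S_set X d le \<phi> x"
  shows "\<phi> y \<le> \<phi> x"
proof -
  have y: "y \<in> X" "\<phi> y + ereal (d y x) \<le> \<phi> x"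
    using assms(2) by (auto simp: S_set_def)
  have "\<phi> y \<le> \<phi> y + ereal (d y x)"
    using nonneg[OF y(1) assms(1)] by (simp add: ereal_le_add_self)
  then show ?thesis using y(2) by (rule order_trans)
qed

text \<open>Finiteness of \<open>\<phi> x\<close> allows it to be cancelled from
  \<open>\<phi> x + d y x \<le> \<phi> x\<close>; at the value \<open>\<infinity>\<close> this
  inequality says nothing about \<open>d y x\<close>.\<close>

lemma (in quasi_metric_space) S_set_eq_dist:
  assumes "x \<in> X" "y \<in> S_set X d le \<phi> x" "\<phi> y = \<phi> x" "\<bar>\<phi> x\<bar> \<noteq> \<infinity>"
  shows "d y x = 0"
proof -
  have y: "y \<in> X" "\<phi> x + ereal (d y x) \<le> \<phi> x"
    using assms(2,3) by (auto simp: S_set_def)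
  then have "d y x \<le> 0" using assms(4) by (cases "\<phi> x") auto
  then show ?thesis using nonneg[OF y(1) assms(1)] by simp
qed

theorem theorem3p8:
  fixes X :: "'a set" and d :: "'a \<Rightarrow> 'a \<Rightarrow> real" and le :: "'a \<Rightarrow> 'a \<Rightarrow> bool"
    and \<phi> :: "'a \<Rightarrow> ereal"
  assumes "preordered_quasi_metric_space X d le"
    and "ext_real_fun X \<phi>"
    and "proper_fun X \<phi>"
    and "bounded_below_fun X \<phi>"
  defines "S \<equiv> S_set X d le \<phi>"
  defines "wEk \<equiv> \<exists>z \<in> eff_dom X \<phi>. \<forall>y \<in> S z. \<phi> y = \<phi> z"
    and "Tak \<equiv> (\<forall>x \<in> eff_dom X \<phi>. (INF u\<in>X. \<phi> u) < \<phi> x \<longrightarrow> (\<exists>y \<in> S x. \<phi> y < \<phi> x))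
                 \<longrightarrow> (\<exists>z \<in> eff_dom X \<phi>. \<phi> z = (INF u\<in>X. \<phi> u))"
    and "Car \<equiv> \<forall>T. T \<in> X \<rightarrow> X \<and> (\<forall>x \<in> eff_dom X \<phi>. T x \<in> S x)
                 \<longrightarrow> (\<exists>z \<in> eff_dom X \<phi>. \<phi> (T z) = \<phi> z \<and> T z \<in> qtopology X d closure_of {z})"
  shows "(wEk \<longleftrightarrow> Tak) \<and> (Tak \<longleftrightarrow> Car)"
proof -
  interpret preordered_quasi_metric_space X d le by fact
  have dom: "x \<in> X" "\<bar>\<phi> x\<bar> \<noteq> \<infinity>" if "x \<in> eff_dom X \<phi>" for x
    using that assms(2) by (auto simp: eff_dom_def ext_real_fun_def)
  have S_X: "S x \<subseteq> X" for x
    by (auto simp: S_def S_set_def)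
  have descent: "\<exists>y\<in>S x. \<phi> y < \<phi> x" if nwEk: "\<not> wEk" and x: "x \<in> eff_dom X \<phi>" for x
  proof -
    obtain y where "y \<in> S x" "\<phi> y \<noteq> \<phi> x"
      using nwEk x unfolding wEk_def by blast
    then show ?thesis
      using S_set_le[OF dom(1)[OF x], of y le \<phi>] by (auto simp: S_def order_less_le)
  qed
  have inf_le: "(INF u\<in>X. \<phi> u) \<le> \<phi> y" if "y \<in> X" for y
    using that by (rule INF_lower)
  have "Tak" if wEk
  proof -
    obtain z where z: "z \<in> eff_dom X \<phi>" "\<And>y. y \<in> S z \<Longrightarrow> \<phi> y = \<phi> z"
      using \<open>wEk\<close> unfolding wEk_def by blast
    show ?thesis
      unfolding Tak_def
    \<comment> \<open>The point \<open>z\<close> from \<open>wEk\<close> is itself the minimizer: if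
      its value exceeded the infimum, the premise would give a strictly smaller value on
      \<open>S z\<close>.\<close>
    proof (intro impI bexI[OF _ z(1)])
      assume "\<forall>x \<in> eff_dom X \<phi>. (INF u\<in>X. \<phi> u) < \<phi> x \<longrightarrow> (\<exists>y \<in> S x. \<phi> y < \<phi> x)"
      then have "\<not> (INF u\<in>X. \<phi> u) < \<phi> z"
        using z by fastforce
      then show "\<phi> z = (INF u\<in>X. \<phi> u)"
        using inf_le[OF dom(1)[OF z(1)]] by (simp add: order_less_le)
    qed
  qed
  moreover have wEk if Tak
  proof (rule ccontr)
    assume "\<not> wEk"
    then obtain z where z: "z \<in> eff_dom X \<phi>" "\<phi> z = (INF u\<in>X. \<phi> u)"
      using \<open>Tak\<close> descent unfolding Tak_def by blast
    obtain y where y: "y \<in> S z" "\<phi> y < \<phi> z"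
      using descent[OF \<open>\<not> wEk\<close> z(1)] by blast
    have "\<phi> z \<le> \<phi> y"
      unfolding z(2) using y(1) S_X by (intro inf_le) blast
    then show False
      using y(2) by simp
  qed
  moreover have Car if wEk
  proof -
    obtain z where z: "z \<in> eff_dom X \<phi>" "\<And>y. y \<in> S z \<Longrightarrow> \<phi> y = \<phi> z"
      using \<open>wEk\<close> unfolding wEk_def by blast
    \<comment> \<open>All of \<open>S z\<close> lies in the closure of \<open>z\<close>, so the same
      \<open>z\<close> serves every mapping \<open>T\<close>.\<close>
    have "y \<in> qtopology X d closure_of {z}" if "y \<in> S z" for y
    proof (rule in_closure_of_singletonI)
      show "z \<in> X" "y \<in> X"
        using dom(1)[OF z(1)] S_X that by blast+
      show "d y z = 0"
        using S_set_eq_dist[OF dom(1)[OF z(1)] _ z(2)[OF that] dom(2)[OF z(1)]] that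
        unfolding S_def by blast
    qed
    then show ?thesis
      unfolding Car_def using z by blast
  qed
  moreover have wEk if Car
  proof (rule ccontr)
    assume "\<not> wEk"
    then obtain f where f: "\<And>x. x \<in> eff_dom X \<phi> \<Longrightarrow> f x \<in> S x \<and> \<phi> (f x) < \<phi> x"
      using descent by metis
    \<comment> \<open>The choice \<open>f\<close> is constrained only on the domain; the identity
      elsewhere keeps \<open>T\<close> a map from \<open>X\<close> to \<open>X\<close>.\<close>
    define T where "T x = (if x \<in> eff_dom X \<phi> then f x else x)" for x
    have "T \<in> X \<rightarrow> X" "\<forall>x\<in>eff_dom X \<phi>. T x \<in> S x"
      using f S_X by (fastforce simp: T_def)+
    then obtain z where z: "z \<in> eff_dom X \<phi>" "\<phi> (T z) = \<phi> z"
      using \<open>Car\<close> unfolding Car_def by blast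
    then show False
      using f[OF z(1)] by (simp add: T_def)
  qed
  ultimately show ?thesis by blast
qed

end
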